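(* Let $\lambda$ and $\mu$ be partitions of a positive integer $n$. If $\lambda\ge_c\mu$ in the consumption ordering, then $\lambda\ge\mu$ in the dominance ordering.
   Context: Let $[n]=\{1,\ldots,n\}$. A set partition $[n]=A_1\cup\cdots\cup A_k$ is said to distinguish a subgroup $H$ of $S_n$ if the only element of $H$ that maps each $A_i$ to itself is the identity. A subgroup $H\le S_n$ consumes a partition $\lambda\vdash n$ if there is a set partition of $[n]$ whose block sizes, in decreasing order, are the parts of $\lambda$, and which distinguishes $H$. The consumption ordering is defined on partitions of $n$ by: $\lambda\ge_c\mu$ if every subgroup $H\le S_n$ that consumes $\lambda$ also consumes $\mu$. The dominance ordering is defined, for partitions of $n$ with parts written in decreasing order (and padded with zeros), by: $\lambda\ge\mu$ if and only if $\sum_{i=1}^k\lambda_i\ge\sum_{i=1}^k\mu_i$ for all $k\geq 1$. *)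

theory Defs
  imports "HOL-Algebra.Sym_Groups" "HOL-Library.Disjoint_Sets" "HOL-Library.Multiset"
begin

text \<open>Partitions of \<open>n\<close> are lists of positive naturals in weakly decreasing order.\<close>

definition partition_of :: "nat \<Rightarrow> nat list \<Rightarrow> bool" where
  "partition_of n l \<longleftrightarrow> sorted_wrt (\<ge>) l \<and> (\<forall>x\<in>set l. 0 < x) \<and> sum_list l = n"

text \<open>The \<open>i\<close>-th part, counted from \<open>1\<close>, with the list padded by zeros.\<close>

definition nth_part :: "nat list \<Rightarrow> nat \<Rightarrow> nat" where
  "nth_part l i = (if 1 \<le> i \<and> i \<le> length l then l ! (i - 1) else 0)"

definition dominates :: "nat list \<Rightarrow> nat list \<Rightarrow> bool" where
  "dominates l m \<longleftrightarrow> (\<forall>k\<ge>1. (\<Sum>i=1..k. nth_part m i) \<le> (\<Sum>i=1..k. nth_part l i))"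

definition distinguishes :: "nat set set \<Rightarrow> (nat \<Rightarrow> nat) set \<Rightarrow> bool" where
  "distinguishes P H \<longleftrightarrow> (\<forall>h\<in>H. (\<forall>A\<in>P. h ` A = A) \<longrightarrow> h = id)"

definition block_sizes :: "nat set set \<Rightarrow> nat list" where
  "block_sizes P = rev (sorted_list_of_multiset (image_mset card (mset_set P)))"

definition consumes :: "nat \<Rightarrow> (nat \<Rightarrow> nat) set \<Rightarrow> nat list \<Rightarrow> bool" where
  "consumes n H l \<longleftrightarrow>
     (\<exists>P. partition_on {1..n} P \<and> block_sizes P = l \<and> distinguishes P H)"

definition consumption_ge :: "nat \<Rightarrow> nat list \<Rightarrow> nat list \<Rightarrow> bool" where
  "consumption_ge n l m \<longleftrightarrow>
     (\<forall>H. subgroup H (sym_group n) \<longrightarrow> consumes n H l \<longrightarrow> consumes n H m)"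

end

theory Submission
  imports Defs
begin

text \<open>Fill the Young diagram of \<open>\<lambda>\<close> with the numbers \<open>1, \<dots>, n\<close>, and let \<open>H\<close> be the group of
  permutations that preserve its columns. The rows distinguish \<open>H\<close>, so \<open>H\<close> consumes \<open>\<lambda>\<close>, hence \<open>\<mu>\<close>.
  As \<open>H\<close> contains all transpositions within a column, every block of a partition distinguishing \<open>H\<close>
  meets each column at most once. So the union of \<open>k\<close> such blocks has at most \<open>k\<close> elements in each
  column, and therefore at most as many elements as the first \<open>k\<close> rows of the diagram.\<close>

lemma sum_nth_part: "(\<Sum>i=1..k. nth_part l i) = sum_list (take k l)"
proof (induction k)
  case (Suc k)
  then show ?case
    by (cases "k < length l") (auto simp: nth_part_def take_Suc_conv_app_nth)
qed simp

text \<open>Listing the blocks from largest to smallest, with ties in any order, turns a sum of the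
  first \<open>k\<close> parts into the total size of \<open>k\<close> specific blocks.\<close>

lemma block_sizes_eq_map_card:
  assumes "finite P"
  obtains ps where "distinct ps" "set ps = P" "map card ps = block_sizes P"
proof -
  obtain qs where qs: "set qs = P" "distinct qs"
    using assms finite_distinct_list by blast
  define ps where "ps = rev (sort_key card qs)"
  have "mset_set P = mset qs"
    using qs mset_set_set by blast
  then have "block_sizes P = rev (sort (map card qs))"
    by (simp add: block_sizes_def flip: mset_map)
  also have "sort (map card qs) = map card (sort_key card qs)"
    by (intro properties_for_sort) auto
  finally have "map card ps = block_sizes P"
    by (simp add: ps_def rev_map)
  then show thesis
    using that[of ps] qs by (simp add: ps_def)
qed

text \<open>Used to see that the rows of the diagram realise the given partition. Injectivity of
  \<open>R\<close> keeps rows of equal length apart, so that repeated parts keep their multiplicity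
  in \<open>mset_set\<close>.\<close>

lemma block_sizes_image:
  assumes "inj_on R {..<length l}"
    and "\<And>i. i < length l \<Longrightarrow> card (R i) = l ! i"
    and "sorted_wrt (\<ge>) l"
  shows "block_sizes (R ` {..<length l}) = l"
proof -
  have "image_mset card (mset_set (R ` {..<length l})) = image_mset (\<lambda>i. l ! i) (mset_set {..<length l})"
    using assms(1,2) by (auto simp flip: image_mset_mset_set simp: multiset.map_comp intro!: image_mset_cong)
  also have "\<dots> = mset (map (\<lambda>i. l ! i) [0..<length l])"
    by (simp add: lessThan_atLeast0)
  also have "\<dots> = mset l"
    by (simp only: map_nth)
  finally have "block_sizes (R ` {..<length l}) = rev (sort l)"
    by (simp add: block_sizes_def)
  also have "sort l = rev l"
    using assms(3) by (intro properties_for_sort) (auto simp: sorted_wrt_rev)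
  finally show ?thesis
    by simp
qed

text \<open>This is the Young subgroup given by the fibres of \<open>c\<close> on
  \<open>{1..n}\<close>. Letting \<open>x\<close> range over all naturals adds no constraint, since
  \<open>p\<close> fixes every point outside \<open>{1..n}\<close>.\<close>

definition fibre_group :: "nat \<Rightarrow> (nat \<Rightarrow> 'a) \<Rightarrow> (nat \<Rightarrow> nat) set" where
  "fibre_group n c = {p. p permutes {1..n} \<and> (\<forall>x. c (p x) = c x)}"

lemma subgroup_fibre_group: "subgroup (fibre_group n c) (sym_group n)"
proof (rule group.subgroupI[OF sym_group_is_group])
  show "fibre_group n c \<subseteq> carrier (sym_group n)"
    by (auto simp: fibre_group_def sym_group_carrier)
  have "id \<in> fibre_group n c"
    by (simp add: fibre_group_def permutes_id)
  then show "fibre_group n c \<noteq> {}"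
    by blast
next
  fix p assume "p \<in> fibre_group n c"
  then have p: "p permutes {1..n}" and c: "\<And>x. c (p x) = c x"
    by (auto simp: fibre_group_def)
  have "c (inv_into UNIV p x) = c x" for x
    using c[of "inv_into UNIV p x"] permutes_inverses(1)[OF p] by simp
  then show "inv\<^bsub>sym_group n\<^esub> p \<in> fibre_group n c"
    using p by (simp add: fibre_group_def sym_group_carrier sym_group_inv_equality permutes_inv)
next
  fix p q assume "p \<in> fibre_group n c" "q \<in> fibre_group n c"
  then show "p \<otimes>\<^bsub>sym_group n\<^esub> q \<in> fibre_group n c"
    by (auto simp: fibre_group_def sym_group_def permutes_compose)
qed

lemma distinguishes_fibre_group_inj_on:
  assumes P: "partition_on {1..n} P" and dist: "distinguishes P (fibre_group n c)" and "A \<in> P"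
  shows "inj_on c A"
proof (rule inj_onI)
  fix x y assume xy: "x \<in> A" "y \<in> A" and c: "c x = c y"
  have sub: "A \<subseteq> {1..n}"
    using P \<open>A \<in> P\<close> by (auto simp: partition_on_def)
  have "transpose x y permutes {1..n}"
    using xy sub by (intro permutes_swap_id) auto
  then have "transpose x y \<in> fibre_group n c"
    using c by (auto simp: fibre_group_def transpose_def)
  moreover have "transpose x y ` B = B" if "B \<in> P" for B
  proof -
    \<comment> \<open>Either \<open>B\<close> is \<open>A\<close> and contains both points, or it is
      disjoint from \<open>A\<close> and contains neither.\<close>
    have "x \<in> B \<longleftrightarrow> y \<in> B"
      using P that \<open>A \<in> P\<close> xy by (auto simp: partition_on_def disjoint_def)
    then show ?thesis
      by (simp add: transpose_image_eq)
  qed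
  ultimately have "transpose x y = id"
    using dist by (auto simp: distinguishes_def)
  then show "x = y"
    by (metis id_apply transpose_apply_first)
qed

definition diagram :: "nat list \<Rightarrow> (nat \<times> nat) set" where
  "diagram l = (SIGMA i:{..<length l}. {..<l ! i})"

lemma card_diagram: "card (diagram l) = sum_list l"
  by (simp add: diagram_def sum_list_sum_nth lessThan_atLeast0)

lemma diagram_take: "diagram (take k l) = {c \<in> diagram l. fst c < k}"
  by (auto simp: diagram_def)

lemma finite_diagram: "finite (diagram l)"
  by (simp add: diagram_def)

text \<open>Row lengths decrease weakly, so the rows that reach column \<open>j\<close> form an
  initial segment; cutting it off after \<open>k\<close> rows leaves the smaller of \<open>k\<close>
  and the column height.\<close>

lemma card_diagram_take_column:
  assumes "sorted_wrt (\<ge>) l"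
  shows "card {c \<in> diagram (take k l). snd c = j} = min k (card {c \<in> diagram l. snd c = j})"
proof -
  define C where "C = {i. i < length l \<and> j < l ! i}"
  have down: "i' \<in> C" if "i \<in> C" "i' \<le> i" for i i'
    using that assms unfolding C_def
    by (cases "i' = i") (auto dest: sorted_wrt_nth_less[of _ l i' i])
  have "finite C"
    by (simp add: C_def)
  \<comment> \<open>A nonempty finite down-closed set of naturals is
    \<open>{..Max C}\<close>.\<close>
  have C: "C = {..<card C}"
  proof (cases "C = {}")
    case False
    then have "C = {..Max C}"
      using down \<open>finite C\<close> by (auto intro: Max_in)
    then show ?thesis
      by (metis card_atMost lessThan_Suc_atMost)
  qed simp
  have "{c \<in> diagram l. snd c = j} = (\<lambda>i. (i, j)) ` C"
    by (auto simp: diagram_def C_def)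
  then have 1: "card {c \<in> diagram l. snd c = j} = card C"
    by (simp add: card_image inj_on_def)
  have "{c \<in> diagram (take k l). snd c = j} = (\<lambda>i. (i, j)) ` (C \<inter> {..<k})"
    by (auto simp: diagram_def C_def)
  then have "card {c \<in> diagram (take k l). snd c = j} = card (C \<inter> {..<k})"
    by (simp add: card_image inj_on_def)
  also have "C \<inter> {..<k} = {..<min k (card C)}"
    by (subst C) auto
  finally show ?thesis
    using 1 by simp
qed

lemma card_eq_sum_fibres:
  assumes "finite A" "finite J" "g ` A \<subseteq> J"
  shows "card A = (\<Sum>j\<in>J. card {x \<in> A. g x = j})"
  using sum.group[OF assms, of "\<lambda>_. 1 :: nat"] by simp

text \<open>Count \<open>U\<close> column by column. The cells of \<open>U\<close> in a column are
  bounded by the column height, as \<open>f\<close> is injective, and by \<open>k\<close>, as each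
  block contributes at most one. The minimum of the two bounds is the height of that column within
  the first \<open>k\<close> rows.\<close>

lemma card_Union_blocks_le:
  assumes sorted: "sorted_wrt (\<ge>) l" and "inj_on f U" and "f ` U \<subseteq> diagram l"
    and U: "U = \<Union>Q" and "finite Q" "card Q \<le> k"
    and inj: "\<And>A. A \<in> Q \<Longrightarrow> inj_on (snd \<circ> f) A"
  shows "card U \<le> sum_list (take k l)"
proof -
  have "finite U"
    using assms finite_diagram by (meson finite_imageD finite_subset)
  let ?J = "snd ` diagram l"
  have "finite ?J"
    by (simp add: finite_diagram)
  have column: "card {x \<in> U. snd (f x) = j} \<le> card {c \<in> diagram (take k l). snd c = j}" for j
  proof -
    let ?V = "{x \<in> U. snd (f x) = j}"
    have "inj_on f ?V" "f ` ?V \<subseteq> {c \<in> diagram l. snd c = j}"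
      using assms(2,3) by (auto simp: inj_on_def)
    then have "card ?V \<le> card {c \<in> diagram l. snd c = j}"
      by (intro card_inj_on_le) (auto simp: finite_diagram)
    moreover have "card ?V \<le> card Q"
    proof -
      have "\<forall>x\<in>U. \<exists>A. A \<in> Q \<and> x \<in> A"
        using U by blast
      \<comment> \<open>The bound by \<open>card Q\<close> comes from sending each point to a block
        containing it: two points with the same column and the same chosen block coincide.\<close>
      then obtain b where b: "\<And>x. x \<in> U \<Longrightarrow> b x \<in> Q \<and> x \<in> b x"
        by (auto dest!: bchoice)
      have "inj_on b ?V"
      proof (rule inj_onI)
        fix x y assume xy: "x \<in> ?V" "y \<in> ?V" "b x = b y"
        then have "x \<in> b x" "y \<in> b x" "b x \<in> Q"
          using b[of x] b[of y] by auto
        then show "x = y"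
          using inj[of "b x"] xy by (auto simp: inj_on_def)
      qed
      then show ?thesis
        using b \<open>finite Q\<close> by (intro card_inj_on_le[of b]) auto
    qed
    ultimately show ?thesis
      using card_diagram_take_column[OF sorted, of k j] \<open>card Q \<le> k\<close> by simp
  qed
  have "card U = (\<Sum>j\<in>?J. card {x \<in> U. snd (f x) = j})"
    using \<open>finite U\<close> \<open>finite ?J\<close> assms(3) by (intro card_eq_sum_fibres) auto
  also have "\<dots> \<le> (\<Sum>j\<in>?J. card {c \<in> diagram (take k l). snd c = j})"
    by (intro sum_mono column)
  also have "\<dots> = card (diagram (take k l))"
    using \<open>finite ?J\<close> finite_diagram
    by (intro card_eq_sum_fibres[symmetric]) (auto simp: diagram_take)
  finally show ?thesis
    by (simp add: card_diagram)
qed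

theorem theorem5p4:
  fixes n :: nat and l m :: "nat list"
  assumes "n \<ge> 1"
    and "partition_of n l"
    and "partition_of n m"
    and "consumption_ge n l m"
  shows "dominates l m"
proof -
  have sorted: "sorted_wrt (\<ge>) l" and pos: "\<And>i. i < length l \<Longrightarrow> 0 < l ! i" and sum: "sum_list l = n"
    using assms(2) by (auto simp: partition_of_def)
  \<comment> \<open>Any filling of the diagram will do; one exists because there are
    \<open>sum_list l = n\<close> cells.\<close>
  obtain f where f: "bij_betw f {1..n} (diagram l)"
    using finite_same_card_bij[of "{1..n}" "diagram l"] by (auto simp: finite_diagram card_diagram sum)
  let ?H = "fibre_group n (snd \<circ> f)"
  define R where "R i = {x \<in> {1..n}. fst (f x) = i}" for i
  have card_R: "card (R i) = l ! i" if "i < length l" for i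
  proof -
    have "f ` R i = {c \<in> f ` {1..n}. fst c = i}"
      by (auto simp: R_def)
    also have "\<dots> = Pair i ` {..<l ! i}"
      using bij_betw_imp_surj_on[OF f] that by (auto simp: diagram_def)
    finally have "f ` R i = Pair i ` {..<l ! i}" .
    moreover have "inj_on f (R i)"
      using bij_betw_imp_inj_on[OF f] by (rule inj_on_subset) (auto simp: R_def)
    ultimately have "card (R i) = card (Pair i ` {..<l ! i})"
      by (metis card_image)
    then show ?thesis
      by (simp add: card_image inj_on_def)
  qed
  \<comment> \<open>Positivity of the parts enters here: it makes the rows pairwise distinct and
    rules out an empty block.\<close>
  have R_nonempty: "R i \<noteq> {}" if "i < length l" for i
    using card_R[OF that] pos[OF that] by auto
  have "inj_on R {..<length l}"
  proof (rule inj_onI)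
    fix i j assume "i \<in> {..<length l}" and eq: "R i = R j"
    then obtain x where "x \<in> R i"
      using R_nonempty[of i] by blast
    moreover from this have "x \<in> R j"
      using eq by simp
    ultimately show "i = j"
      by (simp add: R_def)
  qed
  then have "block_sizes (R ` {..<length l}) = l"
    using card_R sorted by (rule block_sizes_image)
  moreover have "partition_on {1..n} (R ` {..<length l})"
  proof (rule partition_onI)
    have "fst (f x) < length l" if "x \<in> {1..n}" for x
      using bij_betwE[OF f] that by (fastforce simp: diagram_def)
    then show "\<Union> (R ` {..<length l}) = {1..n}"
      by (auto simp: R_def)
  qed (use R_nonempty in \<open>auto simp: R_def disjnt_def\<close>)
  moreover have "distinguishes (R ` {..<length l}) ?H"
    unfolding distinguishes_def
  proof (intro ballI impI)
    fix h assume h: "h \<in> ?H" and rows: "\<forall>A\<in>R ` {..<length l}. h ` A = A"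
    then have perm: "h permutes {1..n}"
      by (simp add: fibre_group_def)
    \<comment> \<open>\<open>h\<close> keeps \<open>x\<close> in its row by \<open>rows\<close> and
      in its column by membership in the group, and a cell is determined by its row and
      column.\<close>
    have "h x = x" if x: "x \<in> {1..n}" for x
    proof -
      have "fst (f x) < length l"
        using bij_betwE[OF f] x by (fastforce simp: diagram_def)
      then have "h ` R (fst (f x)) = R (fst (f x))"
        using rows by simp
      then have "h x \<in> R (fst (f x))"
        using x by (auto simp: R_def)
      then have "h x \<in> {1..n}" "f (h x) = f x"
        using h by (auto simp: R_def fibre_group_def prod_eq_iff)
      then show ?thesis
        using inj_onD[OF bij_betw_imp_inj_on[OF f]] x by blast
    qed
    then show "h = id"
      using permutes_not_in[OF perm] by fastforce
  qed
  ultimately have "consumes n ?H l"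
    unfolding consumes_def by blast
  then have "consumes n ?H m"
    using assms(4) subgroup_fibre_group by (auto simp: consumption_ge_def)
  then obtain P where P: "partition_on {1..n} P" "distinguishes P ?H" "block_sizes P = m"
    by (auto simp: consumes_def)
  have "finite P"
    using P(1) finite_elements by blast
  then obtain ps where ps: "distinct ps" "set ps = P" "map card ps = m"
    using P(3) block_sizes_eq_map_card by metis
  have "sum_list (take k m) \<le> sum_list (take k l)" for k
  proof -
    \<comment> \<open>The \<open>k\<close> largest blocks of \<open>P\<close>, or all of them if
      there are fewer than \<open>k\<close>.\<close>
    define Q where "Q = set (take k ps)"
    have QP: "Q \<subseteq> P"
      using ps(2) set_take_subset by (fastforce simp: Q_def)
    have sub: "\<Union>Q \<subseteq> {1..n}"
      using P(1) QP by (auto simp: partition_on_def)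
    have "sum_list (take k m) = sum_list (map card (take k ps))"
      by (simp add: take_map flip: ps(3))
    also have "\<dots> = (\<Sum>A\<in>Q. card A)"
      using ps(1) by (simp add: Q_def sum_list_distinct_conv_sum_set)
    also have "\<dots> = card (\<Union>Q)"
    proof (rule card_Union_disjoint[symmetric])
      show "disjoint Q"
        using P(1) QP by (auto simp: partition_on_def intro: pairwise_subset)
      show "finite A" if "A \<in> Q" for A
        using that sub by (meson Union_upper finite_atLeastAtMost finite_subset)
    qed
    also have "\<dots> \<le> sum_list (take k l)"
    proof (rule card_Union_blocks_le[OF sorted _ _ refl])
      show "inj_on f (\<Union>Q)" "f ` \<Union>Q \<subseteq> diagram l"
        using inj_on_subset[OF bij_betw_imp_inj_on[OF f] sub] bij_betw_imp_surj_on[OF f] sub by blast+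
      show "card Q \<le> k"
        unfolding Q_def using card_length[of "take k ps"] by simp
      show "inj_on (snd \<circ> f) A" if "A \<in> Q" for A
        using distinguishes_fibre_group_inj_on[OF P(1,2)] that QP by blast
    qed (simp add: Q_def)
    finally show ?thesis .
  qed
  then show ?thesis
    by (simp only: dominates_def sum_nth_part) simp
qed

end
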